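(* Let $l\ge 2$ and $k\ge 2l+1$. For any double-wedge pattern $\tau\in S_{2l}$ that is an involution avoiding $132$, $$I_{(\tau,2l+1,2l+2,\dots,k)}(x)=I_{12\dots k}(x),$$ where $(\tau,2l+1,\dots,k)\in S_k$ is the permutation obtained from $\tau$ by appending $2l+1,\dots,k$, and for a pattern $\rho$, $I_\rho(x)=\sum_{n\ge 0}I_\rho(n)x^n$ with $I_\rho(n)$ the number of involutions in $S_n$ avoiding both $132$ and $\rho$.
   Context: $S_n$ is the set of permutations of $\{1,\dots,n\}$, written in one-line notation. A permutation $\alpha\in S_n$ contains a pattern $\tau\in S_k$ if there are $1\le i_1<\dots<i_k\le n$ such that $(\alpha_{i_1},\dots,\alpha_{i_k})$ is order-isomorphic to $\tau$; otherwise it avoids $\tau$. An involution is a permutation equal to its own inverse; the empty permutation is counted for $n=0$. A permutation $\sigma\in S_m$ ($m\ge1$) is a wedge pattern if it can be written as a concatenation $\sigma=(\tau^1,\rho^1,\dots,\tau^r,\rho^r)$ such that each $\tau^i$ is nonempty, $(\tau^1,\tau^2,\dots,\tau^r)=(s+1,s+2,\dots,m)$ for some $s\ge 0$, and $(\rho^1,\dots,\rho^r)$ is a layered permutation of $1,\dots,s$ with layers $\rho^1,\dots,\rho^r$; that is, each $\rho^i$ is a (possibly empty) increasing sequence of consecutive integers and every entry of $\rho^i$ is larger than every entry of $\rho^{i'}$ whenever $i<i'$. For example $645783912$ and $456378129$ are wedge patterns. For a sequence $\sigma$, $\sigma+l$ denotes the sequence obtained by adding $l$ to every entry. A permutation $\tau\in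 S_{2l}$ is a double-wedge pattern if there is a wedge pattern $\sigma\in S_{l-1}$ such that $\tau=(\sigma^{-1}+l,\,2l,\,\sigma,\,l)$ or $\tau=(\sigma+l,\,2l,\,\sigma^{-1},\,l)$. *)

theory Defs
  imports
    "HOL-Combinatorics.Permutations"
    "HOL-Library.Sublist"
    "HOL-Computational_Algebra.Formal_Power_Series"
begin

text \<open>
  A permutation in \<open>S\<^sub>n\<close> is a function \<open>p :: nat \<Rightarrow> nat\<close> with \<open>p permutes {1..n}\<close>;
  sequences, in particular one-line notations, are lists. For \<open>n = 0\<close> the only
  permutation is the identity, with empty one-line notation.
\<close>

definition one_line :: "nat \<Rightarrow> (nat \<Rightarrow> nat) \<Rightarrow> nat list" where
  "one_line n p = map p [1..<Suc n]"

definition order_isomorphic :: "nat list \<Rightarrow> nat list \<Rightarrow> bool" where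
  "order_isomorphic xs ys \<longleftrightarrow>
     length xs = length ys \<and>
     (\<forall>i<length xs. \<forall>j<length xs. xs ! i < xs ! j \<longleftrightarrow> ys ! i < ys ! j)"

definition contains_pattern :: "nat list \<Rightarrow> nat list \<Rightarrow> bool" where
  "contains_pattern \<alpha> \<tau> \<longleftrightarrow> (\<exists>\<beta>. subseq \<beta> \<alpha> \<and> order_isomorphic \<beta> \<tau>)"

abbreviation avoids_pattern :: "nat list \<Rightarrow> nat list \<Rightarrow> bool" where
  "avoids_pattern \<alpha> \<tau> \<equiv> \<not> contains_pattern \<alpha> \<tau>"

definition involution_on :: "nat \<Rightarrow> (nat \<Rightarrow> nat) \<Rightarrow> bool" where
  "involution_on n p \<longleftrightarrow> p permutes {1..n} \<and> inv p = p"

text \<open>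
  The list \<open>bs\<close> consists of the pairs \<open>(\<tau>\<^sup>i, \<rho>\<^sup>i)\<close>. An interval \<open>[a..<b]\<close> may be empty,
  so the layers \<open>\<rho>\<^sup>i\<close> may be empty as well. There is at least one pair because \<open>m \<ge> 1\<close>.
\<close>

definition wedge_pattern :: "nat \<Rightarrow> (nat \<Rightarrow> nat) \<Rightarrow> bool" where
  "wedge_pattern m \<sigma> \<longleftrightarrow>
     m \<ge> 1 \<and> \<sigma> permutes {1..m} \<and>
     (\<exists>(bs :: (nat list \<times> nat list) list) s.
        one_line m \<sigma> = concat (map (\<lambda>(t, r). t @ r) bs) \<and>
        (\<forall>t \<in> set (map fst bs). t \<noteq> []) \<and>
        concat (map fst bs) = [s + 1..<m + 1] \<and>
        set (concat (map snd bs)) = {1..s} \<and> distinct (concat (map snd bs)) \<and>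
        (\<forall>r \<in> set (map snd bs). \<exists>a b. r = [a..<b]) \<and>
        sorted_wrt (\<lambda>r r'. \<forall>x \<in> set r. \<forall>y \<in> set r'. x > y) (map snd bs))"

definition shift :: "nat \<Rightarrow> nat list \<Rightarrow> nat list" where
  "shift l xs = map (\<lambda>x. x + l) xs"

definition double_wedge_pattern :: "nat \<Rightarrow> (nat \<Rightarrow> nat) \<Rightarrow> bool" where
  "double_wedge_pattern l \<tau> \<longleftrightarrow>
     \<tau> permutes {1..2 * l} \<and>
     (\<exists>\<sigma>. wedge_pattern (l - 1) \<sigma> \<and>
        (one_line (2 * l) \<tau> =
           shift l (one_line (l - 1) (inv \<sigma>)) @ [2 * l] @ one_line (l - 1) \<sigma> @ [l] \<or>
         one_line (2 * l) \<tau> =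
           shift l (one_line (l - 1) \<sigma>) @ [2 * l] @ one_line (l - 1) (inv \<sigma>) @ [l]))"

definition num_involutions :: "nat list \<Rightarrow> nat \<Rightarrow> nat" where
  "num_involutions \<rho> n =
     card {p. involution_on n p \<and>
              avoids_pattern (one_line n p) [1, 3, 2] \<and> avoids_pattern (one_line n p) \<rho>}"

definition involution_gf :: "nat list \<Rightarrow> int fps" where
  "involution_gf \<rho> = Abs_fps (\<lambda>n. int (num_involutions \<rho> n))"

end

theory Submission
  imports Defs
begin

text \<open>
  A nonempty \<open>132\<close>-avoider is \<open>(\<alpha> \<oplus> 1) \<ominus> \<beta>\<close> with \<open>\<alpha>\<close>, \<open>\<beta>\<close> avoiding \<open>132\<close>, so \<open>132\<close>-avoiders are
  binary trees. Let \<open>F\<^sub>p(y)\<close> count the \<open>132\<close>-avoiders that avoid \<open>p\<close>. Splitting host and pattern gives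
  \<open>F = 1 + y F\<^sub>p F\<close> for the pattern \<open>p \<oplus> 1\<close> and \<open>F = 1 + y (F\<^sub>p F + (F - F\<^sub>p) F\<^bsub>r \<oplus> 1\<^esub>)\<close> for
  \<open>(p \<oplus> 1) \<ominus> (r \<oplus> 1)\<close>. By the addition theorem for Chebyshev polynomials, \<open>F\<close> then depends only
  on the length of the pattern, for every pattern built with these two operations. Wedge and
  double-wedge patterns and their inverses are of this kind.

  A nonempty \<open>132\<close>-avoiding involution is \<open>\<alpha> \<oplus> 1\<close> with an involution \<open>\<alpha>\<close>, or
  \<open>(\<alpha> \<oplus> 1) \<ominus> \<gamma> \<ominus> (\<alpha>\<inverse> \<oplus> 1)\<close> with an involution \<open>\<gamma>\<close> and an arbitrary \<open>\<alpha>\<close>. Hence, for an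
  involution \<open>p\<close>, \<open>I\<^bsub>p \<oplus> 1\<^esub> (1 - x\<^sup>2 F\<^sub>p(x\<^sup>2)) = 1 + x I\<^sub>p\<close>, so that appending new maxima preserves equality
  of the series for patterns of equal length. The same decomposition gives
  \<open>I (1 - x - x\<^sup>2 F\<^sub>s(x\<^sup>2)) = 1\<close> for the double wedge \<open>(s \<oplus> 1) \<ominus> (s\<inverse> \<oplus> 1)\<close>, and \<open>I\<^bsub>12\<dots>2l\<^esub>\<close> satisfies the
  same equation.
\<close>

section \<open>Pattern containment in sums and skew sums\<close>

lemma order_isomorphic_refl [simp]: "order_isomorphic xs xs"
  by (simp add: order_isomorphic_def)

lemma order_isomorphic_sym: "order_isomorphic xs ys \<Longrightarrow> order_isomorphic ys xs"
  by (auto simp: order_isomorphic_def)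

lemma order_isomorphic_trans [trans]:
  "order_isomorphic xs ys \<Longrightarrow> order_isomorphic ys zs \<Longrightarrow> order_isomorphic xs zs"
  by (auto simp: order_isomorphic_def)

lemma order_isomorphic_shift: "order_isomorphic (shift l xs) xs"
  by (auto simp: order_isomorphic_def shift_def)

lemma shift_simps [simp]:
  "shift 0 xs = xs" "shift l [] = []" "shift l (x # xs) = (x + l) # shift l xs"
  "shift l (xs @ ys) = shift l xs @ shift l ys" "shift l (shift m xs) = shift (l + m) xs"
  by (simp_all add: shift_def)

lemma length_shift [simp]: "length (shift l xs) = length xs"
  by (simp add: shift_def)

text \<open>A concatenation has comparisons inside its blocks and across them. Both cross directions
  appear because lists may have ties, so neither direction determines the other.\<close>

lemma order_isomorphic_append_iff:
  assumes "length x = length x'"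
  shows "order_isomorphic (x @ y) (x' @ y') \<longleftrightarrow>
    order_isomorphic x x' \<and> order_isomorphic y y' \<and>
    (\<forall>i<length x. \<forall>j<length y. (x ! i < y ! j \<longleftrightarrow> x' ! i < y' ! j) \<and> (y ! j < x ! i \<longleftrightarrow> y' ! j < x' ! i))"
    (is "?L \<longleftrightarrow> ?R")
proof
  assume L: ?L
  hence len: "length y = length y'" using assms by (simp add: order_isomorphic_def)
  have *: "(x @ y) ! i < (x @ y) ! j \<longleftrightarrow> (x' @ y') ! i < (x' @ y') ! j"
    if "i < length x + length y" "j < length x + length y" for i j
    using L that by (simp add: order_isomorphic_def)
  have "x ! i < x ! j \<longleftrightarrow> x' ! i < x' ! j" if "i < length x" "j < length x" for i j
    using *[of i j] that assms by (simp add: nth_append)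
  moreover have "y ! i < y ! j \<longleftrightarrow> y' ! i < y' ! j" if "i < length y" "j < length y" for i j
    using *[of "length x + i" "length x + j"] that assms by (simp add: nth_append)
  moreover have "(x ! i < y ! j \<longleftrightarrow> x' ! i < y' ! j) \<and> (y ! j < x ! i \<longleftrightarrow> y' ! j < x' ! i)"
    if "i < length x" "j < length y" for i j
    using *[of i "length x + j"] *[of "length x + j" i] that assms by (simp add: nth_append)
  ultimately show ?R using assms len by (simp add: order_isomorphic_def)
next
  assume R: ?R
  hence len: "length y = length y'" by (simp add: order_isomorphic_def)
  have "(x @ y) ! i < (x @ y) ! j \<longleftrightarrow> (x' @ y') ! i < (x' @ y') ! j"
    if "i < length x + length y" "j < length x + length y" for i j
    using R that assms len
    by (cases "i < length x"; cases "j < length x")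
       (auto simp: order_isomorphic_def nth_append)
  thus ?L using assms len by (simp add: order_isomorphic_def)
qed

text \<open>\<open>x @ y\<close> is a skew sum when \<open>above x y\<close>, and a direct sum when
  \<open>above y x\<close>. Working with raw values avoids renormalising the blocks. Empty lists
  satisfy the relation vacuously, so it is not transitive.\<close>

definition above :: "nat list \<Rightarrow> nat list \<Rightarrow> bool" where
  "above xs ys \<longleftrightarrow> (\<forall>x\<in>set xs. \<forall>y\<in>set ys. y < x)"

lemma above_simps [simp]:
  "above [] ys" "above xs []"
  "above (x # xs) ys \<longleftrightarrow> (\<forall>y\<in>set ys. y < x) \<and> above xs ys"
  "above xs (y # ys) \<longleftrightarrow> (\<forall>x\<in>set xs. y < x) \<and> above xs ys"
  "above (xs @ xs') ys \<longleftrightarrow> above xs ys \<and> above xs' ys"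
  "above xs (ys @ ys') \<longleftrightarrow> above xs ys \<and> above xs ys'"
  by (auto simp: above_def)

lemma above_conv_nth:
  "above xs ys \<longleftrightarrow> (\<forall>i<length xs. \<forall>j<length ys. ys ! j < xs ! i)"
  by (auto simp: above_def all_set_conv_all_nth)

lemma above_subseq: "above x y \<Longrightarrow> subseq x' x \<Longrightarrow> subseq y' y \<Longrightarrow> above x' y'"
  by (metis above_def notin_set_nthsI subseq_conv_nths)

text \<open>Under \<open>above x y\<close> every cross comparison has a fixed outcome, so matching
  all of them amounts to \<open>above x' y'\<close>.\<close>

lemma order_isomorphic_skew:
  assumes "above x y" "length x = length x'"
  shows "order_isomorphic (x @ y) (x' @ y') \<longleftrightarrow>
    order_isomorphic x x' \<and> order_isomorphic y y' \<and> above x' y'"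
proof -
  have "length y = length y'" if "order_isomorphic y y'"
    using that by (simp add: order_isomorphic_def)
  thus ?thesis
    using assms unfolding order_isomorphic_append_iff[OF assms(2)] above_conv_nth
    by (metis order_less_asym)
qed

lemma order_isomorphic_direct:
  assumes "above y x" "length x = length x'"
  shows "order_isomorphic (x @ y) (x' @ y') \<longleftrightarrow>
    order_isomorphic x x' \<and> order_isomorphic y y' \<and> above y' x'"
proof -
  have "length y = length y'" if "order_isomorphic y y'"
    using that by (simp add: order_isomorphic_def)
  thus ?thesis
    using assms unfolding order_isomorphic_append_iff[OF assms(2)] above_conv_nth
    by (metis order_less_asym)
qed

lemma order_isomorphic_singleton [simp]: "order_isomorphic [a] ys \<longleftrightarrow> (\<exists>b. ys = [b])"
  by (auto simp: order_isomorphic_def length_Suc_conv eq_commute[of "Suc 0"])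

lemma order_isomorphic_Nil [simp]: "order_isomorphic [] ys \<longleftrightarrow> ys = []"
  "order_isomorphic xs [] \<longleftrightarrow> xs = []"
  by (auto simp: order_isomorphic_def)

lemma contains_pattern_Nil [simp]: "contains_pattern xs []" "contains_pattern [] xs \<longleftrightarrow> xs = []"
  by (auto simp: contains_pattern_def dest: list_emb_Nil2)

lemma contains_pattern_order_isomorphic:
  "order_isomorphic p q \<Longrightarrow> contains_pattern xs p \<longleftrightarrow> contains_pattern xs q"
  unfolding contains_pattern_def
  by (meson order_isomorphic_sym order_isomorphic_trans)

lemma contains_pattern_subseq:
  "subseq xs ys \<Longrightarrow> contains_pattern xs p \<Longrightarrow> contains_pattern ys p"
  unfolding contains_pattern_def using subseq_order.trans by blast

text \<open>Stated for the set of matched pairs, the condition is inherited by subsets; restriction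
  to a subpattern relies on this.\<close>

lemma order_isomorphic_conv_zip:
  "order_isomorphic xs ys \<longleftrightarrow> length xs = length ys \<and>
    (\<forall>(x, y)\<in>set (zip xs ys). \<forall>(x', y')\<in>set (zip xs ys). x < x' \<longleftrightarrow> y < y')"
  by (fastforce simp: order_isomorphic_def set_zip)

text \<open>\<open>\<gamma>\<close> takes from \<open>\<beta>\<close> the entries at the positions
  where \<open>q\<close> sits inside \<open>p\<close>.\<close>

lemma subseq_zip:
  assumes "subseq q p" "length \<beta> = length p"
  shows "\<exists>\<gamma>. subseq \<gamma> \<beta> \<and> length \<gamma> = length q \<and> set (zip \<gamma> q) \<subseteq> set (zip \<beta> p)"
  using assms
proof (induction arbitrary: \<beta> rule: list_emb.induct)
  case (list_emb_Nil p)
  show ?case by (rule exI[of _ "[]"]) simp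
next
  case (list_emb_Cons q p a)
  then obtain b \<beta>' where [simp]: "\<beta> = b # \<beta>'" and "length \<beta>' = length p"
    by (cases \<beta>) auto
  with list_emb_Cons.IH obtain \<gamma> where
    "subseq \<gamma> \<beta>' \<and> length \<gamma> = length q \<and> set (zip \<gamma> q) \<subseteq> set (zip \<beta>' p)" by blast
  moreover from this have "subseq \<gamma> \<beta>" by (simp add: list_emb.intros(2))
  ultimately show ?case by auto
next
  case (list_emb_Cons2 a c q p)
  then obtain b \<beta>' where [simp]: "\<beta> = b # \<beta>'" and "length \<beta>' = length p"
    by (cases \<beta>) auto
  with list_emb_Cons2.IH obtain \<gamma> where
    "subseq \<gamma> \<beta>' \<and> length \<gamma> = length q \<and> set (zip \<gamma> q) \<subseteq> set (zip \<beta>' p)" by blast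
  with list_emb_Cons2.hyps show ?case by (intro exI[of _ "b # \<gamma>"]) auto
qed

lemma contains_pattern_sub_pattern:
  assumes "subseq q p" "contains_pattern xs p"
  shows "contains_pattern xs q"
proof -
  obtain \<beta> where \<beta>: "subseq \<beta> xs" "order_isomorphic \<beta> p"
    using assms(2) by (auto simp: contains_pattern_def)
  obtain \<gamma> where \<gamma>: "subseq \<gamma> \<beta>" "length \<gamma> = length q" "set (zip \<gamma> q) \<subseteq> set (zip \<beta> p)"
    using subseq_zip[OF assms(1)] \<beta>(2) by (metis order_isomorphic_def)
  have "order_isomorphic \<gamma> q"
    using \<beta>(2) \<gamma>(2,3) unfolding order_isomorphic_conv_zip by blast
  thus ?thesis
    using \<beta>(1) \<gamma>(1) subseq_order.trans unfolding contains_pattern_def by blast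
qed

lemma contains_pattern_cong_host:
  assumes "order_isomorphic xs ys" "contains_pattern xs p"
  shows "contains_pattern ys p"
proof -
  obtain \<beta> where \<beta>: "subseq \<beta> xs" "order_isomorphic \<beta> p"
    using assms(2) by (auto simp: contains_pattern_def)
  \<comment> \<open>The host takes the role of a pattern: \<open>ys\<close> is itself an occurrence
    of \<open>xs\<close>, and \<open>\<beta>\<close> is a subpattern of \<open>xs\<close>.\<close>
  have "contains_pattern ys xs"
    using assms(1) order_isomorphic_sym unfolding contains_pattern_def by blast
  thus ?thesis
    using contains_pattern_sub_pattern[OF \<beta>(1)] contains_pattern_order_isomorphic[OF \<beta>(2)] by blast
qed

lemma contains_pattern_shift [simp]:
  "contains_pattern (shift l xs) p \<longleftrightarrow> contains_pattern xs p"
  "contains_pattern xs (shift l p) \<longleftrightarrow> contains_pattern xs p"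
  using contains_pattern_cong_host order_isomorphic_shift order_isomorphic_sym
    contains_pattern_order_isomorphic by blast+

text \<open>An occurrence is cut at the boundary of the two blocks, and the resulting cut of the
  pattern inherits \<open>above\<close>. Either part may be empty.\<close>

lemma contains_pattern_skew:
  assumes "above x y"
  shows "contains_pattern (x @ y) p \<longleftrightarrow>
    (\<exists>p1 p2. p = p1 @ p2 \<and> above p1 p2 \<and> contains_pattern x p1 \<and> contains_pattern y p2)"
proof
  assume "contains_pattern (x @ y) p"
  then obtain \<beta> \<gamma> where *: "subseq \<beta> x" "subseq \<gamma> y" "order_isomorphic (\<beta> @ \<gamma>) p"
    unfolding contains_pattern_def by (metis subseq_append_iff)
  have ab: "above \<beta> \<gamma>"
    using assms *(1,2) by (rule above_subseq)
  define p1 p2 where "p1 = take (length \<beta>) p" and "p2 = drop (length \<beta>) p"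
  have p: "p = p1 @ p2" "length \<beta> = length p1"
    using *(3) by (auto simp: p1_def p2_def order_isomorphic_def)
  show "\<exists>p1 p2. p = p1 @ p2 \<and> above p1 p2 \<and> contains_pattern x p1 \<and> contains_pattern y p2"
    using *(1,2) p *(3) order_isomorphic_skew[OF ab p(2), of p2]
    unfolding contains_pattern_def by blast
next
  assume "\<exists>p1 p2. p = p1 @ p2 \<and> above p1 p2 \<and> contains_pattern x p1 \<and> contains_pattern y p2"
  then obtain p1 p2 \<beta> \<gamma> where p: "p = p1 @ p2" "above p1 p2"
    and \<beta>: "subseq \<beta> x" "order_isomorphic \<beta> p1" and \<gamma>: "subseq \<gamma> y" "order_isomorphic \<gamma> p2"
    unfolding contains_pattern_def by blast
  have "above \<beta> \<gamma>"
    using assms \<beta>(1) \<gamma>(1) by (rule above_subseq)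
  hence "order_isomorphic (\<beta> @ \<gamma>) p"
    using \<beta> \<gamma> p order_isomorphic_skew[of \<beta> \<gamma> p1 p2] by (simp add: order_isomorphic_def[of \<beta>])
  thus "contains_pattern (x @ y) p"
    using \<beta>(1) \<gamma>(1) unfolding contains_pattern_def by (meson list_emb_append_mono)
qed

lemma contains_pattern_append_max:
  assumes "above [n] x"
  shows "contains_pattern (x @ [n]) p \<longleftrightarrow>
    contains_pattern x p \<or> (\<exists>q m. p = q @ [m] \<and> above [m] q \<and> contains_pattern x q)"
proof
  assume "contains_pattern (x @ [n]) p"
  then obtain \<beta> \<gamma> where *: "subseq \<beta> x" "subseq \<gamma> [n]" "order_isomorphic (\<beta> @ \<gamma>) p"
    unfolding contains_pattern_def by (metis subseq_append_iff)
  have "\<gamma> = [] \<or> \<gamma> = [n]"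
    using *(2) by (cases \<gamma>) (auto split: if_splits)
  moreover have "\<exists>q m. p = q @ [m] \<and> above [m] q \<and> contains_pattern x q" if [simp]: "\<gamma> = [n]"
  proof -
    have ab: "above [n] \<beta>"
      using assms *(1) above_subseq by blast
    obtain q m where p: "p = q @ [m]" and len: "length \<beta> = length q"
      using *(3) by (metis \<open>\<gamma> = [n]\<close> length_append_singleton length_Suc_conv_rev order_isomorphic_def)
    show ?thesis
      using *(1,3) p order_isomorphic_direct[OF ab len, of "[m]"]
      unfolding contains_pattern_def by auto
  qed
  ultimately show "contains_pattern x p \<or> (\<exists>q m. p = q @ [m] \<and> above [m] q \<and> contains_pattern x q)"
    using * unfolding contains_pattern_def by auto
next
  have "contains_pattern (x @ [n]) (q @ [m])"
    if q: "above [m] q" "contains_pattern x q" for q m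
  proof -
    obtain \<beta> where \<beta>: "subseq \<beta> x" "order_isomorphic \<beta> q"
      using q(2) by (auto simp: contains_pattern_def)
    have ab: "above [n] \<beta>"
      using assms \<beta>(1) above_subseq by blast
    have "order_isomorphic (\<beta> @ [n]) (q @ [m])"
      using \<beta> q(1) order_isomorphic_direct[OF ab, of q "[m]"]
      by (simp add: order_isomorphic_def[of \<beta>])
    moreover have "subseq (\<beta> @ [n]) (x @ [n])" using \<beta>(1) by simp
    ultimately show ?thesis unfolding contains_pattern_def by blast
  qed
  moreover have "subseq x (x @ [n])" using prefixI prefix_imp_subseq by blast
  moreover assume "contains_pattern x p \<or> (\<exists>q m. p = q @ [m] \<and> above [m] q \<and> contains_pattern x q)"
  ultimately show "contains_pattern (x @ [n]) p"
    using contains_pattern_subseq by blast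
qed

section \<open>Binary trees and 132-avoiding permutations\<close>

text \<open>\<open>Node a b\<close> stands for (a \<oplus> 1) \<ominus> b. The generated
  \<open>size\<close> counts nodes, so it is the length of the permutation.\<close>

datatype shape = Leaf | Node shape shape

primrec word :: "shape \<Rightarrow> nat list" where
  "word Leaf = []"
| "word (Node a b) = shift (size b) (word a) @ [size a + size b + 1] @ word b"

lemma length_word [simp]: "length (word t) = size t"
  by (induction t) auto

lemma set_shift: "set (shift l xs) = (\<lambda>x. x + l) ` set xs"
  by (simp add: shift_def)

lemma set_word: "set (word t) = {1..size t}"
proof (induction t)
  case (Node a b)
  have "(\<lambda>x. x + size b) ` {1..size a} = {size b + 1..size a + size b}"
    by (simp add: image_add_atLeastAtMost' add.commute)
  thus ?case using Node by (auto simp: set_shift)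
qed simp

lemma above_word: "above [size a + size b + 1] (shift (size b) (word a))"
  "above (shift (size b) (word a) @ [size a + size b + 1]) (word b)"
  by (auto simp: above_def set_shift set_word)

text \<open>A right spine lists the skew components of a word, and the inverse of \<open>\<alpha> \<ominus> \<beta>\<close> is
  \<open>\<beta>\<inverse> \<ominus> \<alpha>\<inverse>\<close>.\<close>

primrec snoc :: "shape \<Rightarrow> shape \<Rightarrow> shape" where
  "snoc Leaf d = Node d Leaf"
| "snoc (Node a b) d = Node a (snoc b d)"

primrec shape_inv :: "shape \<Rightarrow> shape" where
  "shape_inv Leaf = Leaf"
| "shape_inv (Node a b) = snoc (shape_inv b) (shape_inv a)"

lemma size_snoc [simp]: "size (snoc c d) = Suc (size c + size d)"
  by (induction c) auto

lemma size_shape_inv [simp]: "size (shape_inv t) = size t"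
  by (induction t) auto

lemma shape_inv_snoc [simp]: "shape_inv (snoc c d) = Node (shape_inv d) (shape_inv c)"
  by (induction c) auto

lemma shape_inv_shape_inv [simp]: "shape_inv (shape_inv t) = t"
  by (induction t) auto

lemma snoc_inject [simp]: "snoc c d = snoc c' d' \<longleftrightarrow> c = c' \<and> d = d'"
  using shape_inv_snoc shape_inv_shape_inv by (metis shape.inject)

lemma snoc_neq_Leaf [simp]: "snoc c d \<noteq> Leaf"
  by (cases c) auto

text \<open>Inversion reverses the order of the skew components and inverts each. A fixed tree
  therefore has a single self-inverse component, or its first and last components are mutually
  inverse around a self-inverse middle \<open>c\<close>.\<close>

lemma shape_inv_fixed_cases:
  "shape_inv t = t \<longleftrightarrow> t = Leaf \<or> (\<exists>a. shape_inv a = a \<and> t = Node a Leaf) \<or>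
    (\<exists>a c. shape_inv c = c \<and> t = Node a (snoc c (shape_inv a)))" (is "?L \<longleftrightarrow> ?R")
proof
  assume L: ?L
  show ?R
  proof (cases t)
    case [simp]: (Node a b)
    show ?thesis
    proof (cases "shape_inv b")
      case Leaf
      hence "b = Leaf" by (metis shape_inv_shape_inv shape_inv.simps(1))
      thus ?thesis using L by simp
    next
      case (Node a' c)
      hence "snoc c (shape_inv a) = b" "a' = a" using L by auto
      moreover have "b = snoc (shape_inv c) (shape_inv a')" using Node by (metis shape_inv_shape_inv shape_inv.simps(2))
      ultimately show ?thesis by auto
    qed
  qed simp
qed auto

lemma word_snoc: "word (snoc c d) = shift (Suc (size d)) (word c) @ word d @ [Suc (size d)]"
  by (induction c) (simp_all add: add_ac)

section \<open>Inverse permutations as converse graphs\<close>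

definition graph :: "nat list \<Rightarrow> (nat \<times> nat) set" where
  "graph xs = {(Suc i, xs ! i) | i. i < length xs}"

lemma graph_append: "graph (xs @ ys) = graph xs \<union> (\<lambda>(i, v). (i + length xs, v)) ` graph ys"
proof -
  have "graph (xs @ ys) \<subseteq> graph xs \<union> (\<lambda>(i, v). (i + length xs, v)) ` graph ys"
  proof
    fix z assume "z \<in> graph (xs @ ys)"
    then obtain i where i: "i < length xs + length ys" "z = (Suc i, (xs @ ys) ! i)"
      by (auto simp: graph_def)
    show "z \<in> graph xs \<union> (\<lambda>(i, v). (i + length xs, v)) ` graph ys"
    proof (cases "i < length xs")
      case False
      hence "(Suc (i - length xs), ys ! (i - length xs)) \<in> graph ys"
        using i by (auto simp: graph_def)
      moreover have "z = (\<lambda>(i, v). (i + length xs, v)) (Suc (i - length xs), ys ! (i - length xs))"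
        using i False by (simp add: nth_append)
      ultimately show ?thesis by blast
    qed (use i in \<open>auto simp: graph_def nth_append\<close>)
  qed
  moreover have "graph xs \<subseteq> graph (xs @ ys)"
    by (auto simp: graph_def nth_append)
  moreover have "(i + length xs, v) \<in> graph (xs @ ys)" if iv: "(i, v) \<in> graph ys" for i v
  proof -
    obtain j where "j < length ys" "i = Suc j" "v = ys ! j" using iv by (auto simp: graph_def)
    thus ?thesis unfolding graph_def by (auto simp: add.commute[of j] intro!: exI[of _ "length xs + j"])
  qed
  ultimately show ?thesis by auto
qed

lemma graph_shift: "graph (shift l xs) = (\<lambda>(i, v). (i, v + l)) ` graph xs"
  by (auto simp: graph_def shift_def image_def)

lemma graph_singleton [simp]: "graph [v] = {(1, v)}" "graph [] = {}"
  by (auto simp: graph_def)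

lemma graph_Cons: "graph (v # xs) = insert (1, v) ((\<lambda>(i, v). (Suc i, v)) ` graph xs)"
  using graph_append[of "[v]" xs] by simp

text \<open>With positions counted from 1, inversion of a permutation is the converse of its graph.
  Each block is a translated copy of a smaller graph, and passing to the inverse tree exchanges its
  position offset with its value offset.\<close>

lemma graph_shape_inv: "graph (word (shape_inv t)) = (graph (word t))\<inverse>"
proof (induction t)
  case (Node a b)
  have *: "(\<lambda>(i, v). (f i, g v)) ` R\<inverse> = ((\<lambda>(i, v). (g i, f v)) ` R)\<inverse>" for f g :: "nat \<Rightarrow> nat" and R
    by auto
  have 1: "graph (word (shape_inv (Node a b))) =
      (\<lambda>(i, v). (i, v + Suc (size a))) ` graph (word (shape_inv b)) \<union>
      (\<lambda>(i, v). (i + size b, v)) ` graph (word (shape_inv a)) \<union> {(size a + size b + 1, Suc (size a))}"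
    by (simp add: word_snoc graph_append graph_Cons graph_shift image_Un case_prod_beta image_image add_ac Un_ac)
  have 2: "graph (word (Node a b)) =
      (\<lambda>(i, v). (i + Suc (size a), v)) ` graph (word b) \<union>
      (\<lambda>(i, v). (i, v + size b)) ` graph (word a) \<union> {(Suc (size a), size a + size b + 1)}"
    by (simp add: graph_append graph_Cons graph_shift image_Un case_prod_beta image_image add_ac Un_ac)
  show ?case
    unfolding 1 2 Node by (subst *)+ (auto simp: converse_Un)
qed simp

lemma graph_inject:
  assumes "graph xs = graph ys" "length xs = length ys"
  shows "xs = ys"
  using assms(2)
proof (rule nth_equalityI)
  fix i assume "i < length xs"
  hence "(Suc i, xs ! i) \<in> graph ys" unfolding assms(1)[symmetric] by (auto simp: graph_def)
  thus "xs ! i = ys ! i" by (auto simp: graph_def)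
qed

lemma length_one_line [simp]: "length (one_line n p) = n"
  by (simp add: one_line_def)

lemma nth_one_line [simp]: "i < n \<Longrightarrow> one_line n p ! i = p (Suc i)"
  by (simp add: one_line_def nth_append del: upt_Suc)

lemma graph_one_line: "graph (one_line n p) = {(i, p i) | i. i \<in> {1..n}}"
proof -
  have "{(i, p i) | i. i \<in> {1..n}} = {(Suc i, p (Suc i)) | i. i < n}"
    by (auto simp: less_eq_Suc_le) (metis Suc_le_D)
  thus ?thesis by (auto simp: graph_def)
qed

lemma one_line_inv:
  assumes "p permutes {1..n}" "one_line n p = word t"
  shows "one_line n (inv p) = word (shape_inv t)"
proof (rule graph_inject)
  have n: "n = size t" using assms(2) by (metis length_one_line length_word)
  show "length (one_line n (inv p)) = length (word (shape_inv t))" by (simp add: n)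
  have "{(i, inv p i) | i. i \<in> {1..n}} = {(i, p i) | i. i \<in> {1..n}}\<inverse>"
    using permutes_inverses[OF assms(1)] permutes_in_image[OF assms(1)]
      permutes_in_image[OF permutes_inv[OF assms(1)]] by auto
  thus "graph (one_line n (inv p)) = graph (word (shape_inv t))"
    unfolding graph_shape_inv assms(2)[symmetric] graph_one_line .
qed

lemma one_line_inject:
  assumes "p permutes {1..n}" "q permutes {1..n}" "one_line n p = one_line n q"
  shows "p = q"
proof
  fix i
  show "p i = q i"
  proof (cases "i \<in> {1..n}")
    case True
    then obtain j where "i = Suc j" "j < n" by (cases i) auto
    thus ?thesis using assms(3) nth_one_line by metis
  next
    case False
    thus ?thesis using assms(1,2) by (metis permutes_not_in)
  qed
qed

lemma set_one_line: "p permutes {1..n} \<Longrightarrow> set (one_line n p) = {1..n}"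
  using permutes_image[of p "{1..n}"] by (simp add: one_line_def atLeastLessThanSuc_atLeastAtMost del: upt_Suc)

lemma ex_one_line:
  assumes "set xs = {1..length xs}"
  shows "\<exists>p. p permutes {1..length xs} \<and> one_line (length xs) p = xs"
proof -
  \<comment> \<open>The identity outside the index range is what \<open>permutes\<close>
    demands.\<close>
  define p where "p i = (if i \<in> {1..length xs} then xs ! (i - 1) else i)" for i
  have eq: "one_line (length xs) p = xs"
    by (rule nth_equalityI) (auto simp: p_def)
  have "p ` {1..length xs} = set (one_line (length xs) p)"
    by (simp add: one_line_def atLeastLessThanSuc_atLeastAtMost del: upt_Suc)
  hence img: "p ` {1..length xs} = {1..length xs}" using eq assms by simp
  hence "bij_betw p {1..length xs} {1..length xs}"
    by (simp add: bij_betw_def eq_card_imp_inj_on)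
  hence "p permutes {1..length xs}"
    by (rule bij_imp_permutes) (auto simp: p_def)
  thus ?thesis using eq by blast
qed

text \<open>An entry of a permutation of 1, ..., n is the number of entries not exceeding it, and
  this number depends only on the relative order.\<close>

lemma order_isomorphic_unique:
  assumes "order_isomorphic xs ys" "set xs = {1..length xs}" "set ys = {1..length xs}"
  shows "xs = ys"
proof -
  have len: "length ys = length xs" using assms(1) by (simp add: order_isomorphic_def)
  have *: "zs ! i = card {j. j < length zs \<and> zs ! j \<le> zs ! i}"
    if "set zs = {1..length zs}" "i < length zs" for zs i
  proof -
    have "distinct zs" using that by (intro card_distinct) simp
    have "zs ! i \<in> {1..length zs}" using that by (metis nth_mem)
    hence "{1..zs ! i} = {v \<in> set zs. v \<le> zs ! i}" using that by auto
    also have "\<dots> = (!) zs ` {j. j < length zs \<and> zs ! j \<le> zs ! i}"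
      by (auto simp: in_set_conv_nth)
    also have "card \<dots> = card {j. j < length zs \<and> zs ! j \<le> zs ! i}"
      using inj_on_nth[OF \<open>distinct zs\<close>] by (intro card_image) auto
    finally show ?thesis by simp
  qed
  show ?thesis
  proof (rule nth_equalityI)
    fix i assume i: "i < length xs"
    have "{j. j < length xs \<and> xs ! j \<le> xs ! i} = {j. j < length ys \<and> ys ! j \<le> ys ! i}"
      using assms(1) i len unfolding order_isomorphic_def by (auto simp flip: not_less)
    thus "xs ! i = ys ! i"
      using *[of xs i] *[of ys i] assms i len by metis
  qed (simp add: len)
qed

section \<open>The bijection between trees and 132-avoiders\<close>

lemma order_isomorphic_word_Node:
  assumes "order_isomorphic xs (word a)" "order_isomorphic ys (word b)"
    and "above [m] xs" "above (xs @ [m]) ys"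
  shows "order_isomorphic (xs @ [m] @ ys) (word (Node a b))"
proof -
  have len: "length xs = size a" using assms(1) by (simp add: order_isomorphic_def)
  have "order_isomorphic xs (shift (size b) (word a))"
    using assms(1) order_isomorphic_shift order_isomorphic_sym order_isomorphic_trans by blast
  hence "order_isomorphic (xs @ [m]) (shift (size b) (word a) @ [size a + size b + 1])"
    using assms(3) above_word(1) len by (subst order_isomorphic_direct) auto
  hence "order_isomorphic ((xs @ [m]) @ ys) ((shift (size b) (word a) @ [size a + size b + 1]) @ word b)"
    using assms(2,4) above_word(2) len by (subst order_isomorphic_skew) auto
  thus ?thesis by simp
qed

text \<open>Split at the maximum \<open>n\<close>: an entry before it that is smaller than an entry
  after it would form 132 together with \<open>n\<close>, so the left block lies above the right
  one. Distinct lists are used instead of permutations so that the induction applies to both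
  blocks.\<close>

lemma avoids_132_order_isomorphic_word:
  assumes "distinct xs" "avoids_pattern xs [1, 3, 2]"
  shows "\<exists>t. order_isomorphic xs (word t)"
  using assms
proof (induction "length xs" arbitrary: xs rule: less_induct)
  case less
  show ?case
  proof (cases "xs = []")
    case True
    thus ?thesis by (intro exI[of _ Leaf]) simp
  next
    case False
    hence "Max (set xs) \<in> set xs" by simp
    then obtain x y where xs: "xs = x @ Max (set xs) # y" by (meson split_list)
    define n where "n = Max (set xs)"
    have xs: "xs = x @ [n] @ y" using xs by (simp add: n_def)
    have "v \<le> n" if "v \<in> set xs" for v using that by (simp add: n_def)
    hence lt: "v < n" if "v \<in> set x \<or> v \<in> set y" for v
      using that less.prems(1) by (metis Un_iff distinct.simps(2) distinct_append append_Cons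
        disjoint_iff le_neq_implies_less list.set_intros(1) set_append xs list.set_intros(2) append_Nil)
    have gt: "c < a" if ac: "a \<in> set x" "c \<in> set y" for a c
    proof (rule ccontr)
      assume "\<not> c < a"
      hence "a < c" using ac less.prems(1) by (fastforce simp: xs)
      have "order_isomorphic [a, n, c] [1, 3, 2]"
        using \<open>a < c\<close> lt[of c] ac by (auto simp: order_isomorphic_def less_Suc_eq numeral_3_eq_3)
      moreover have "subseq ([a] @ [n] @ [c]) xs"
        using ac unfolding xs by (intro list_emb_append_mono) (auto simp: subseq_singleton_left)
      ultimately show False using less.prems(2) by (auto simp: contains_pattern_def)
    qed
    have "subseq x xs" "subseq y xs" by (auto simp: xs)
    hence "avoids_pattern x [1, 3, 2]" "avoids_pattern y [1, 3, 2]"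
      using less.prems(2) contains_pattern_subseq by blast+
    then obtain a b where "order_isomorphic x (word a)" "order_isomorphic y (word b)"
      using less.hyps[of x] less.hyps[of y] less.prems(1) by (fastforce simp: xs)
    hence "order_isomorphic xs (word (Node a b))"
      unfolding xs using lt gt by (intro order_isomorphic_word_Node) (auto simp: above_def)
    thus ?thesis by blast
  qed
qed

lemma word_surj:
  assumes "set xs = {1..length xs}" "avoids_pattern xs [1, 3, 2]"
  shows "\<exists>t. xs = word t"
proof -
  have "distinct xs" using assms(1) by (intro card_distinct) simp
  then obtain t where t: "order_isomorphic xs (word t)"
    using avoids_132_order_isomorphic_word assms(2) by blast
  hence "length xs = size t" by (simp add: order_isomorphic_def)
  hence "xs = word t"
    using t assms(1) by (intro order_isomorphic_unique) (auto simp: set_word)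
  thus ?thesis ..
qed

text \<open>132 neither ends in its maximum nor is a proper skew sum, so an occurrence would lie
  entirely in one subtree.\<close>

lemma word_avoids_132: "avoids_pattern (word t) [1, 3, 2]"
proof (induction t)
  case (Node a b)
  have "avoids_pattern (shift (size b) (word a) @ [size a + size b + 1]) [1, 3, 2]"
    using Node above_word(1) by (subst contains_pattern_append_max) auto
  hence "avoids_pattern ((shift (size b) (word a) @ [size a + size b + 1]) @ word b) [1, 3, 2]"
    using Node above_word(2) by (subst contains_pattern_skew) (auto simp: Cons_eq_append_conv)
  thus ?case by simp
qed simp

text \<open>The maximum occurs exactly once and marks the root, so the two subtrees can be read off
  on either side of it.\<close>

lemma word_inject [simp]: "word t = word u \<longleftrightarrow> t = u"
proof
  show "word t = word u \<Longrightarrow> t = u"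
  proof (induction t arbitrary: u)
    case Leaf
    thus ?case by (cases u) auto
  next
    case (Node a b)
    then obtain c d where u: "u = Node c d" by (cases u) auto
    have sz: "size a + size b = size c + size d"
      using arg_cong[OF Node.prems, of length] by (simp add: u)
    let ?n = "size a + size b + 1"
    have "?n \<notin> set (shift (size b) (word a))" "?n \<notin> set (word b)"
      using above_word(1)[of a b] by (auto simp: set_word)
    moreover have "shift (size b) (word a) @ ?n # word b = shift (size d) (word c) @ ?n # word d"
      using Node.prems sz by (simp add: u)
    ultimately have eq: "shift (size b) (word a) = shift (size d) (word c)" "word b = word d"
      by (simp_all add: append_Cons_eq_iff)
    hence "b = d" using Node.IH(2) by blast
    moreover have "word a = word c"
      using eq(1) \<open>b = d\<close> by (auto simp: shift_def dest!: map_injective intro!: injI)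
    ultimately show ?case using Node.IH(1) u by blast
  qed
qed simp

text \<open>On the two sets being counted, \<open>one_line\<close> and \<open>word\<close> are
  injective and have the same image.\<close>

lemma num_involutions_conv_shape:
  "num_involutions \<rho> n = card {t. size t = n \<and> shape_inv t = t \<and> avoids_pattern (word t) \<rho>}"
proof -
  let ?T = "{t. size t = n \<and> shape_inv t = t \<and> avoids_pattern (word t) \<rho>}"
  let ?P = "{p. involution_on n p \<and>
    avoids_pattern (one_line n p) [1, 3, 2] \<and> avoids_pattern (one_line n p) \<rho>}"
  have "one_line n ` ?P = word ` ?T"
  proof (intro equalityI subsetI)
    fix xs assume "xs \<in> one_line n ` ?P"
    then obtain p where p: "p permutes {1..n}" "inv p = p" "avoids_pattern xs [1, 3, 2]"
      "avoids_pattern xs \<rho>" "xs = one_line n p" by (auto simp: involution_on_def)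
    obtain t where t: "one_line n p = word t"
      using word_surj[of xs] p set_one_line[OF p(1)] by auto
    have "word (shape_inv t) = word t"
      using one_line_inv[OF p(1) t] t p(2) by simp
    moreover have "size t = n" using t by (metis length_one_line length_word)
    ultimately show "xs \<in> word ` ?T" using p t by auto
  next
    fix xs assume "xs \<in> word ` ?T"
    then obtain t where t: "xs = word t" "size t = n" "shape_inv t = t" "avoids_pattern xs \<rho>" by auto
    obtain p where p: "p permutes {1..n}" "one_line n p = word t"
      using ex_one_line[of "word t"] set_word[of t] t(2) by auto
    have "inv p = p"
      using one_line_inv[OF p] p t(3) permutes_inv by (intro one_line_inject[of _ n]) auto
    thus "xs \<in> one_line n ` ?P"
      using p t word_avoids_132[of t] by (auto simp: involution_on_def intro!: image_eqI[of _ _ p])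
  qed
  moreover have "card (one_line n ` ?P) = card ?P"
    by (intro card_image inj_onI) (auto simp: involution_on_def intro: one_line_inject)
  moreover have "card (word ` ?T) = card ?T"
    by (intro card_image inj_onI) auto
  ultimately show ?thesis by (simp add: num_involutions_def)
qed

section \<open>Containment in trees\<close>

definition avoids :: "shape \<Rightarrow> shape \<Rightarrow> bool" where
  "avoids t p \<longleftrightarrow> avoids_pattern (word t) (word p)"

lemma contains_pattern_word_Node:
  "contains_pattern (word (Node a b)) P \<longleftrightarrow>
    (\<exists>p1 p2. P = p1 @ p2 \<and> above p1 p2 \<and> contains_pattern (word b) p2 \<and>
      (contains_pattern (word a) p1 \<or>
        (\<exists>q m. p1 = q @ [m] \<and> above [m] q \<and> contains_pattern (word a) q)))"
proof -
  have "word (Node a b) = (shift (size b) (word a) @ [size a + size b + 1]) @ word b" by simp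
  thus ?thesis
    by (simp only: contains_pattern_skew[OF above_word(2)] contains_pattern_append_max[OF above_word(1)]
        contains_pattern_shift) blast
qed

text \<open>A pattern ending in its maximum is not a proper skew sum, so it lies wholly on one side
  of the cut. On the left side the root can always play \<open>m\<close>, which leaves only
  \<open>q\<close> to be found in \<open>a\<close>.\<close>

lemma contains_top:
  assumes "above [m] q"
  shows "contains_pattern (word (Node a b)) (q @ [m]) \<longleftrightarrow>
    contains_pattern (word a) q \<or> contains_pattern (word b) (q @ [m])" (is "?L \<longleftrightarrow> ?R")
proof
  assume ?L
  then obtain p1 p2 where p: "q @ [m] = p1 @ p2" "above p1 p2" "contains_pattern (word b) p2"
    "contains_pattern (word a) p1 \<or>
      (\<exists>q m. p1 = q @ [m] \<and> above [m] q \<and> contains_pattern (word a) q)"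
    unfolding contains_pattern_word_Node by blast
  show ?R
  proof (cases p2 rule: rev_cases)
    case Nil
    hence "p1 = q @ [m]" using p(1) by simp
    moreover have "contains_pattern (word a) (q @ [m]) \<Longrightarrow> contains_pattern (word a) q"
      using contains_pattern_sub_pattern prefixI prefix_imp_subseq by blast
    ultimately show ?thesis using p(4) by auto
  next
    case (snoc p2' m')
    hence "m' = m" "q = p1 @ p2'" using p(1) by auto
    hence "p1 = []" using assms p(2) snoc by (cases p1) auto
    thus ?thesis using p snoc by simp
  qed
next
  assume ?R
  thus ?L
  proof
    assume "contains_pattern (word a) q"
    thus ?L unfolding contains_pattern_word_Node using assms by (intro exI[of _ "q @ [m]"] exI[of _ "[]"]) auto
  next
    assume "contains_pattern (word b) (q @ [m])"
    thus ?L unfolding contains_pattern_word_Node by (intro exI[of _ "[]"] exI[of _ "q @ [m]"]) auto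
  qed
qed

text \<open>Both blocks end in their maxima, so the pattern can only be cut between them or at its
  ends. Uncut, it does not end in its maximum and cannot use the root; cut between the blocks, it
  uses the root as \<open>m\<close>.\<close>

lemma contains_top_skew_top:
  assumes "above [m] q" "above [k] r" "above (q @ [m]) (r @ [k])"
  shows "contains_pattern (word (Node a b)) ((q @ [m]) @ r @ [k]) \<longleftrightarrow>
    contains_pattern (word a) ((q @ [m]) @ r @ [k]) \<or> contains_pattern (word b) ((q @ [m]) @ r @ [k]) \<or>
    contains_pattern (word a) q \<and> contains_pattern (word b) (r @ [k])" (is "?L \<longleftrightarrow> ?R")
proof
  assume ?L
  then obtain p1 p2 where p: "(q @ [m]) @ r @ [k] = p1 @ p2" "above p1 p2" "contains_pattern (word b) p2"
    "contains_pattern (word a) p1 \<or>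
      (\<exists>q m. p1 = q @ [m] \<and> above [m] q \<and> contains_pattern (word a) q)"
    unfolding contains_pattern_word_Node by blast
  \<comment> \<open>The cut falls after \<open>m\<close> in the first case and before
    \<open>m\<close> in the second.\<close>
  from p(1) consider us where "p1 = (q @ [m]) @ us" "r @ [k] = us @ p2"
    | us where "q @ [m] = p1 @ us" "us \<noteq> []" "p2 = us @ r @ [k]"
    by (auto simp del: append_assoc simp: append_eq_append_conv2) (metis append_Nil2 append_Nil)
  thus ?R
  proof cases
    case 1
    show ?thesis
    proof (cases p2 rule: rev_cases)
      case Nil
      hence p1: "p1 = (q @ [m]) @ r @ [k]" using p(1) by simp
      have "\<not> above [k] ((q @ [m]) @ r)" using assms(3) by auto
      hence "contains_pattern (word a) p1"
        using p(4) unfolding p1 by (auto simp flip: append_assoc)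
      thus ?thesis unfolding p1 by blast
    next
      case (snoc p2' k')
      hence "k' = k" "r = us @ p2'" using 1 by auto
      \<comment> \<open>Entries of \<open>us\<close> would have to exceed \<open>k\<close>, the
        maximum of their own block.\<close>
      hence us: "us = []" using assms(2) p(2) snoc 1 by (cases us) auto
      moreover have "contains_pattern (word a) (q @ [m]) \<Longrightarrow> contains_pattern (word a) q"
        using contains_pattern_sub_pattern prefixI prefix_imp_subseq by blast
      ultimately show ?thesis using p(3,4) 1 by auto
    qed
  next
    case 2
    then obtain us' where us: "us = us' @ [m]" by (cases us rule: rev_cases) auto
    hence "q = p1 @ us'" using 2 by simp
    hence "p1 = []" using assms(1) p(2) 2 us by (cases p1) auto
    thus ?thesis using p by simp
  qed
next
  assume ?R
  then consider "contains_pattern (word a) ((q @ [m]) @ r @ [k])"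
    | "contains_pattern (word b) ((q @ [m]) @ r @ [k])"
    | "contains_pattern (word a) q" "contains_pattern (word b) (r @ [k])" by blast
  thus ?L
  proof cases
    case 1
    thus ?thesis unfolding contains_pattern_word_Node
      by (intro exI[of _ "(q @ [m]) @ r @ [k]"] exI[of _ "[]"]) auto
  next
    case 2
    thus ?thesis unfolding contains_pattern_word_Node
      by (intro exI[of _ "[]"] exI[of _ "(q @ [m]) @ r @ [k]"]) auto
  next
    case 3
    thus ?thesis unfolding contains_pattern_word_Node using assms
      by (intro exI[of _ "q @ [m]"] exI[of _ "r @ [k]"]) auto
  qed
qed

lemma avoids_Leaf [simp]: "avoids t Leaf \<longleftrightarrow> False" "avoids Leaf p \<longleftrightarrow> p \<noteq> Leaf"
  using word_inject[of p Leaf] by (auto simp: avoids_def simp del: word_inject)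

lemma avoids_Node_top:
  "avoids (Node a b) (Node p Leaf) \<longleftrightarrow> avoids a p \<and> avoids b (Node p Leaf)"
  using contains_top[of "size p + 1" "word p" a b] above_word(1)[of p Leaf] by (simp add: avoids_def)

lemma avoids_Node_top_skew_top:
  "avoids (Node a b) (Node p (Node r Leaf)) \<longleftrightarrow>
    avoids a (Node p (Node r Leaf)) \<and> avoids b (Node p (Node r Leaf)) \<and>
    (avoids a p \<or> avoids b (Node r Leaf))"
  using contains_top_skew_top[OF above_word(1)[of p "Node r Leaf"] above_word(1)[of r Leaf], of a b]
    above_word(2)[of "Node r Leaf" p]
  by (auto simp: avoids_def)

lemma avoids_sub_Node: "avoids a p \<Longrightarrow> avoids a (Node p b)" "avoids a p \<Longrightarrow> avoids a (Node b p)"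
proof -
  have "subseq (shift (size b) (word p)) (word (Node p b))" "subseq (word p) (word (Node b p))"
    by (auto intro: list_emb.intros list_emb_append2)
  thus "avoids a p \<Longrightarrow> avoids a (Node p b)" "avoids a p \<Longrightarrow> avoids a (Node b p)"
    unfolding avoids_def using contains_pattern_sub_pattern contains_pattern_shift(2) by blast+
qed

text \<open>Induction along the right spine turns the split at the first skew component into a split
  at the last one.\<close>

lemma avoids_snoc_top:
  "avoids (snoc c d) (Node p Leaf) \<longleftrightarrow> avoids c (Node p Leaf) \<and> avoids d p"
  by (induction c) (auto simp: avoids_Node_top)

text \<open>The last conjunct mirrors that of \<open>avoids_Node_top_skew_top\<close>: here the
  final entry of the host plays the maximum of the right block, so \<open>r\<close> is sought
  without its maximum while the left block keeps its own.\<close>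

lemma avoids_snoc_top_skew_top:
  "avoids (snoc c d) (Node p (Node r Leaf)) \<longleftrightarrow>
    avoids c (Node p (Node r Leaf)) \<and> avoids d (Node p (Node r Leaf)) \<and>
    (avoids c (Node p Leaf) \<or> avoids d r)"
  by (induction c) (auto simp: avoids_Node_top avoids_Node_top_skew_top avoids_snoc_top avoids_sub_Node)

text \<open>Unlike the class of wedge patterns, this one is closed under inversion.\<close>

inductive wedgelike :: "shape \<Rightarrow> bool" where
  wedgelike_Leaf: "wedgelike Leaf"
| wedgelike_top: "wedgelike p \<Longrightarrow> wedgelike (Node p Leaf)"
| wedgelike_skew: "wedgelike p \<Longrightarrow> wedgelike r \<Longrightarrow> wedgelike (Node p (Node r Leaf))"

lemma wedgelike_shape_inv: "wedgelike p \<Longrightarrow> wedgelike (shape_inv p)"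
  by (induction rule: wedgelike.induct) (auto intro: wedgelike.intros)

text \<open>Inverting the host turns \<open>Node\<close> into \<open>snoc\<close>, and inverting a
  skew pattern exchanges \<open>p\<close> and \<open>r\<close> up to inversion. The recursions at
  the first and at the last component match under these exchanges.\<close>

lemma avoids_shape_inv_iff: "wedgelike p \<Longrightarrow> avoids (shape_inv t) (shape_inv p) \<longleftrightarrow> avoids t p"
proof (induction arbitrary: t rule: wedgelike.induct)
  case (wedgelike_top p)
  show ?case
    by (induction t) (auto simp: avoids_Node_top avoids_snoc_top wedgelike_top.IH)
next
  case (wedgelike_skew p r)
  have *: "avoids (shape_inv t) (Node (shape_inv p) Leaf) \<longleftrightarrow> avoids t (Node p Leaf)" for t
    by (induction t) (auto simp: avoids_Node_top avoids_snoc_top wedgelike_skew.IH)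
  have **: "avoids (shape_inv t) (Node (shape_inv r) Leaf) \<longleftrightarrow> avoids t (Node r Leaf)" for t
    by (induction t) (auto simp: avoids_Node_top avoids_snoc_top wedgelike_skew.IH)
  show ?case
    by (induction t) (auto simp: avoids_Node_top_skew_top avoids_snoc_top_skew_top wedgelike_skew.IH * **)
qed simp

section \<open>Wedge patterns\<close>

text \<open>The same closure on lists with arbitrary values, so that wedge patterns can be assembled
  block by block before any standardisation.\<close>

inductive wedgelike_list :: "nat list \<Rightarrow> bool" where
  wedgelike_list_Nil: "wedgelike_list []"
| wedgelike_list_top: "wedgelike_list q \<Longrightarrow> above [m] q \<Longrightarrow> wedgelike_list (q @ [m])"
| wedgelike_list_skew: "wedgelike_list q \<Longrightarrow> wedgelike_list r \<Longrightarrow> above [m] q \<Longrightarrow> above [k] r \<Longrightarrow>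
    above (q @ [m]) (r @ [k]) \<Longrightarrow> wedgelike_list ((q @ [m]) @ r @ [k])"

lemma wedgelike_list_shape: "wedgelike_list xs \<Longrightarrow> \<exists>t. wedgelike t \<and> order_isomorphic xs (word t)"
proof (induction rule: wedgelike_list.induct)
  case wedgelike_list_Nil
  thus ?case using wedgelike_Leaf by (intro exI[of _ Leaf]) auto
next
  case (wedgelike_list_top q m)
  then obtain t where "wedgelike t" "order_isomorphic q (word t)" by blast
  thus ?case
    using order_isomorphic_word_Node[of q t "[]" Leaf m] wedgelike_list_top.hyps wedgelike_top
    by (intro exI[of _ "Node t Leaf"]) auto
next
  case (wedgelike_list_skew q r m k)
  then obtain t u where t: "wedgelike t" "order_isomorphic q (word t)"
    and u: "wedgelike u" "order_isomorphic r (word u)" by blast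
  have "order_isomorphic (r @ [k]) (word (Node u Leaf))"
    using order_isomorphic_word_Node[of r u "[]" Leaf k] wedgelike_list_skew.hyps u by auto
  hence "order_isomorphic (q @ [m] @ r @ [k]) (word (Node t (Node u Leaf)))"
    using t wedgelike_list_skew.hyps by (intro order_isomorphic_word_Node) auto
  thus ?case using wedgelike_skew t u by (intro exI[of _ "Node t (Node u Leaf)"]) auto
qed

lemma wedgelike_list_append_increasing:
  assumes "wedgelike_list xs" "sorted_wrt (<) t" "above t xs"
  shows "wedgelike_list (xs @ t)"
  using assms(2,3)
proof (induction t rule: rev_induct)
  case (snoc m t)
  hence "wedgelike_list (xs @ t)" "above [m] (xs @ t)"
    by (auto simp: sorted_wrt_append)
  thus ?case using wedgelike_list_top by fastforce
qed (use assms in simp)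

text \<open>Reading the pairs from left to right, each \<open>t\<close> lies above everything before
  it and each \<open>r\<close> below. The entries of \<open>t\<close> become new maxima; a nonempty
  \<open>r\<close> is then a skew summand, and the last entries \<open>m\<close> and
  \<open>k\<close> are the maxima of the two summands.\<close>

lemma wedgelike_list_wedge:
  assumes "\<forall>t\<in>set (map fst bs). t \<noteq> []" "sorted_wrt (<) (concat (map fst bs))"
    and "\<forall>r\<in>set (map snd bs). sorted_wrt (<) r" "sorted_wrt above (map snd bs)"
    and "above (concat (map fst bs)) (concat (map snd bs))"
  shows "wedgelike_list (concat (map (\<lambda>(t, r). t @ r) bs))"
  using assms
proof (induction bs rule: rev_induct)
  case (snoc b bs)
  obtain t r where b: "b = (t, r)" by (cases b)
  define xs where "xs = concat (map (\<lambda>(t, r). t @ r) bs)"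
  have xs: "wedgelike_list xs"
    unfolding xs_def using snoc.prems by (intro snoc.IH) (auto simp: sorted_wrt_append)
  have set_xs: "set xs = set (concat (map fst bs)) \<union> set (concat (map snd bs))"
    unfolding xs_def by force
  have t: "t \<noteq> []" "sorted_wrt (<) t" and r: "sorted_wrt (<) r"
    using snoc.prems by (auto simp: b sorted_wrt_append)
  have "above t xs" "above xs r" "above t r"
    using snoc.prems unfolding above_def set_xs
    by (fastforce simp: b sorted_wrt_append above_def)+
  note ab = this
  have "wedgelike_list (xs @ t @ r)"
  proof (cases r rule: rev_cases)
    case Nil
    thus ?thesis using wedgelike_list_append_increasing[OF xs t(2) ab(1)] by simp
  next
    case (snoc r' k)
    obtain t' m where t': "t = t' @ [m]" using t(1) by (cases t rule: rev_cases) auto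
    have "wedgelike_list (xs @ t')"
      using xs t(2) ab(1) by (intro wedgelike_list_append_increasing) (auto simp: t' sorted_wrt_append)
    moreover have "wedgelike_list r'"
      using wedgelike_list_append_increasing[of "[]" r'] wedgelike_list_Nil r snoc by (simp add: sorted_wrt_append)
    ultimately have "wedgelike_list (((xs @ t') @ [m]) @ r' @ [k])"
      using ab t(2) r by (intro wedgelike_list_skew) (auto simp: t' snoc sorted_wrt_append)
    thus ?thesis by (simp add: t' snoc)
  qed
  thus ?case by (simp add: b xs_def)
qed (simp add: wedgelike_list_Nil)

lemma wedge_pattern_shape:
  assumes "wedge_pattern m \<sigma>"
  shows "\<exists>s. wedgelike s \<and> size s = m \<and> one_line m \<sigma> = word s"
proof -
  obtain bs s where \<sigma>: "\<sigma> permutes {1..m}" "one_line m \<sigma> = concat (map (\<lambda>(t, r). t @ r) bs)"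
    and bs: "\<forall>t\<in>set (map fst bs). t \<noteq> []" "concat (map fst bs) = [s + 1..<m + 1]"
      "set (concat (map snd bs)) = {1..s}"
      "\<forall>r\<in>set (map snd bs). \<exists>a b. r = [a..<b]"
      "sorted_wrt (\<lambda>r r'. \<forall>x\<in>set r. \<forall>y\<in>set r'. x > y) (map snd bs)"
    using assms unfolding wedge_pattern_def by blast
  have "wedgelike_list (one_line m \<sigma>)"
    unfolding \<sigma>(2)
  proof (rule wedgelike_list_wedge)
    show "\<forall>r\<in>set (map snd bs). sorted_wrt (<) r" using bs(4) by force
    show "above (concat (map fst bs)) (concat (map snd bs))"
      unfolding above_def bs(2,3) by auto
    show "sorted_wrt (<) (concat (map fst bs))" unfolding bs(2) by (rule sorted_wrt_upt)
    show "sorted_wrt above (map snd bs)" using bs(5) unfolding above_def .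
  qed (use bs in auto)
  then obtain t where t: "wedgelike t" "order_isomorphic (one_line m \<sigma>) (word t)"
    using wedgelike_list_shape by blast
  hence "size t = m" by (simp add: order_isomorphic_def)
  moreover from this have "one_line m \<sigma> = word t"
    using t(2) set_one_line[OF \<sigma>(1)] by (intro order_isomorphic_unique) (auto simp: set_word)
  ultimately show ?thesis using t(1) by blast
qed

text \<open>The two forms of a double wedge differ by replacing \<open>s\<close> with its inverse,
  and the class of \<open>wedgelike\<close> trees is closed under that.\<close>

lemma double_wedge_pattern_shape:
  assumes "l \<ge> 1" "double_wedge_pattern l \<tau>"
  shows "\<exists>s. wedgelike s \<and> size s = l - 1 \<and> one_line (2 * l) \<tau> = word (Node s (Node (shape_inv s) Leaf))"
proof -
  obtain \<sigma> where \<sigma>: "wedge_pattern (l - 1) \<sigma>" and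
    \<tau>: "one_line (2 * l) \<tau> =
           shift l (one_line (l - 1) (inv \<sigma>)) @ [2 * l] @ one_line (l - 1) \<sigma> @ [l] \<or>
         one_line (2 * l) \<tau> =
           shift l (one_line (l - 1) \<sigma>) @ [2 * l] @ one_line (l - 1) (inv \<sigma>) @ [l]"
    using assms(2) unfolding double_wedge_pattern_def by blast
  obtain s where s: "wedgelike s" "size s = l - 1" "one_line (l - 1) \<sigma> = word s"
    using wedge_pattern_shape[OF \<sigma>] by blast
  moreover have "one_line (l - 1) (inv \<sigma>) = word (shape_inv s)"
    using \<sigma> s(3) by (intro one_line_inv) (auto simp: wedge_pattern_def)
  ultimately have "one_line (2 * l) \<tau> = word (Node (shape_inv s) (Node s Leaf)) \<or>
    one_line (2 * l) \<tau> = word (Node s (Node (shape_inv s) Leaf))"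
    using \<tau> assms(1) by (auto simp: mult_2)
  thus ?thesis using s wedgelike_shape_inv[OF s(1)] by (metis size_shape_inv shape_inv_shape_inv)
qed

lemma word_funpow_top:
  "word (((\<lambda>t. Node t Leaf) ^^ k) t) = word t @ [size t + 1..<size t + k + 1]"
  "size (((\<lambda>t. Node t Leaf) ^^ k) t) = size t + k"
proof (induction k)
  case (Suc k)
  { case 1 thus ?case using Suc by simp next case 2 thus ?case using Suc by simp }
qed simp_all

section \<open>Counting series\<close>

definition counting_series :: "('a \<Rightarrow> nat) \<Rightarrow> 'a set \<Rightarrow> int fps" where
  "counting_series f A = Abs_fps (\<lambda>n. int (card {x\<in>A. f x = n}))"

text \<open>Excludes levels where \<open>card\<close> would return 0 for an infinite set, which
  would break additivity and the product rule.\<close>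

definition finite_levels :: "('a \<Rightarrow> nat) \<Rightarrow> 'a set \<Rightarrow> bool" where
  "finite_levels f A \<longleftrightarrow> (\<forall>n. finite {x\<in>A. f x = n})"

lemma finite_levels_subset: "finite_levels f B \<Longrightarrow> A \<subseteq> B \<Longrightarrow> finite_levels f A"
  unfolding finite_levels_def
proof
  fix n
  assume "\<forall>n. finite {x \<in> B. f x = n}" "A \<subseteq> B"
  moreover from this have "{x \<in> A. f x = n} \<subseteq> {x \<in> B. f x = n}" by auto
  ultimately show "finite {x \<in> A. f x = n}" using finite_subset by blast
qed

lemma counting_series_Un:
  assumes "finite_levels f A" "finite_levels f B" "A \<inter> B = {}"
  shows "counting_series f (A \<union> B) = counting_series f A + counting_series f B"
proof (rule fps_ext)
  fix n
  have "{x\<in>A \<union> B. f x = n} = {x\<in>A. f x = n} \<union> {x\<in>B. f x = n}" by blast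
  moreover have "card \<dots> = card {x\<in>A. f x = n} + card {x\<in>B. f x = n}"
    using assms by (intro card_Un_disjoint) (auto simp: finite_levels_def)
  ultimately show "fps_nth (counting_series f (A \<union> B)) n = fps_nth (counting_series f A + counting_series f B) n"
    by (simp add: counting_series_def)
qed

lemma counting_series_Diff:
  assumes "finite_levels f A" "B \<subseteq> A"
  shows "counting_series f (A - B) = counting_series f A - counting_series f B"
proof -
  have "(A - B) \<inter> B = {}" "A - B \<union> B = A" using assms(2) by auto
  thus ?thesis
    using counting_series_Un[of f "A - B" B] assms finite_levels_subset[of f A] by simp
qed

lemma counting_series_image:
  assumes "inj_on h A" "\<And>x. x \<in> A \<Longrightarrow> g (h x) = f x"
  shows "counting_series g (h ` A) = counting_series f A"
proof (rule fps_ext)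
  fix n
  have "{y \<in> h ` A. g y = n} = h ` {x\<in>A. f x = n}" using assms(2) by auto
  moreover have "inj_on h {x\<in>A. f x = n}" using assms(1) by (rule inj_on_subset) auto
  ultimately show "fps_nth (counting_series g (h ` A)) n = fps_nth (counting_series f A) n"
    by (simp add: counting_series_def card_image)
qed

lemma counting_series_add_const:
  "counting_series (\<lambda>x. f x + c) A = fps_X ^ c * counting_series f A"
proof (rule fps_ext)
  fix n
  have "{x\<in>A. f x + c = n} = (if n < c then {} else {x\<in>A. f x = n - c})" by auto
  thus "fps_nth (counting_series (\<lambda>x. f x + c) A) n = fps_nth (fps_X ^ c * counting_series f A) n"
    by (simp add: counting_series_def fps_X_power_mult_nth)
qed

lemma counting_series_Times:
  assumes "finite_levels f A" "finite_levels g B"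
  shows "counting_series (\<lambda>(x, y). f x + g y) (A \<times> B) = counting_series f A * counting_series g B"
proof (rule fps_ext)
  fix n
  have "{z\<in>A \<times> B. (\<lambda>(x, y). f x + g y) z = n} =
      (\<Union>i\<in>{0..n}. {x\<in>A. f x = i} \<times> {y\<in>B. g y = n - i})" by auto
  moreover have "card \<dots> = (\<Sum>i\<in>{0..n}. card ({x\<in>A. f x = i} \<times> {y\<in>B. g y = n - i}))"
    using assms by (intro card_UN_disjoint) (auto simp: finite_levels_def)
  ultimately show "fps_nth (counting_series (\<lambda>(x, y). f x + g y) (A \<times> B)) n =
      fps_nth (counting_series f A * counting_series g B) n"
    by (simp add: counting_series_def fps_mult_nth card_cartesian_product)
qed

lemma counting_series_singleton: "f x = 0 \<Longrightarrow> counting_series f {x} = 1"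
  by (rule fps_ext) (auto simp: counting_series_def fps_one_nth Collect_conv_if2 conj_commute
      intro!: arg_cong[of _ "{_}" card] cong: conj_cong)

section \<open>Trees graded by size, and the series of avoiders\<close>

lemma finite_shapes: "finite {t :: shape. size t \<le> n}"
proof (induction n)
  case 0
  have "size t \<le> 0 \<Longrightarrow> t = Leaf" for t by (cases t) auto
  hence "{t. size t \<le> 0} \<subseteq> {Leaf}" by blast
  thus ?case using finite_subset by blast
next
  case (Suc n)
  have "t \<in> insert Leaf ((\<lambda>(a, b). Node a b) ` ({t. size t \<le> n} \<times> {t. size t \<le> n}))"
    if "size t \<le> Suc n" for t :: shape
    using that by (cases t) auto
  hence "{t. size t \<le> Suc n} \<subseteq> insert Leaf ((\<lambda>(a, b). Node a b) ` ({t. size t \<le> n} \<times> {t. size t \<le> n}))"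
    by blast
  thus ?case using Suc finite_subset by blast
qed

lemma finite_levels_shape: "d > 0 \<Longrightarrow> finite_levels (\<lambda>t :: shape. d * size t) A"
  unfolding finite_levels_def
proof
  fix n
  assume "d > 0"
  hence "{t \<in> A. d * size t = n} \<subseteq> {t. size t \<le> n}" by auto
  thus "finite {t \<in> A. d * size t = n}" using finite_shapes finite_subset by blast
qed

lemma finite_levels_size: "finite_levels (size :: shape \<Rightarrow> nat) A"
  using finite_levels_shape[of 1] by simp

text \<open>The weight \<open>d * size t\<close> yields F(x^d) without composing series; involutions
  need d = 2.\<close>

definition avoid_series :: "nat \<Rightarrow> shape \<Rightarrow> int fps" where
  "avoid_series d p = counting_series (\<lambda>t. d * size t) {t. avoids t p}"

lemma counting_series_Node:
  assumes "d > 0"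
  shows "counting_series (\<lambda>t. d * size t) ((\<lambda>(a, b). Node a b) ` (A \<times> B)) =
    fps_X ^ d * (counting_series (\<lambda>t. d * size t) A * counting_series (\<lambda>t. d * size t) B)"
proof -
  have "counting_series (\<lambda>t. d * size t) ((\<lambda>(a, b). Node a b) ` (A \<times> B)) =
      counting_series (\<lambda>z. (\<lambda>(a, b). d * size a + d * size b) z + d) (A \<times> B)"
    by (rule counting_series_image) (auto simp: inj_on_def algebra_simps)
  thus ?thesis
    using assms by (simp add: counting_series_add_const counting_series_Times finite_levels_shape)
qed

lemma avoid_series_Leaf: "avoid_series d Leaf = 0"
  by (rule fps_ext) (simp add: avoid_series_def counting_series_def)

lemma avoid_series_top:
  assumes "d > 0"
  shows "avoid_series d (Node p Leaf) =
    1 + fps_X ^ d * (avoid_series d p * avoid_series d (Node p Leaf))"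
proof -
  let ?N = "(\<lambda>(a, b). Node a b) ` ({t. avoids t p} \<times> {t. avoids t (Node p Leaf)})"
  have "t \<in> {t. avoids t (Node p Leaf)} \<longleftrightarrow> t \<in> {Leaf} \<union> ?N" for t
    by (cases t) (auto simp: avoids_Node_top)
  hence "{t. avoids t (Node p Leaf)} = {Leaf} \<union> ?N" by blast
  moreover have "counting_series (\<lambda>t. d * size t) ({Leaf} \<union> ?N) =
    counting_series (\<lambda>t. d * size t) {Leaf} + counting_series (\<lambda>t. d * size t) ?N"
    using assms by (intro counting_series_Un finite_levels_shape) auto
  ultimately show ?thesis
    using assms by (simp add: avoid_series_def counting_series_Node counting_series_singleton)
qed

text \<open>Nonempty avoiders \<open>Node a b\<close> fall into two disjoint classes. If
  \<open>a\<close> avoids \<open>p\<close>, only \<open>b\<close> is constrained further, by the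
  whole pattern. Otherwise \<open>a\<close> merely avoids the whole pattern and \<open>b\<close>
  must avoid \<open>Node r Leaf\<close>, which already implies avoiding the whole.\<close>

lemma avoid_series_skew:
  assumes "d > 0"
  defines "F \<equiv> avoid_series d"
  shows "F (Node p (Node r Leaf)) = 1 + fps_X ^ d * (F p * F (Node p (Node r Leaf)) +
    (F (Node p (Node r Leaf)) - F p) * F (Node r Leaf))"
proof -
  let ?P = "Node p (Node r Leaf)"
  let ?N = "(\<lambda>(a, b). Node a b)"
  let ?A = "{t. avoids t ?P}"
  let ?N1 = "?N ` ({t. avoids t p} \<times> ?A)"
  let ?N2 = "?N ` ((?A - {t. avoids t p}) \<times> {t. avoids t (Node r Leaf)})"
  let ?c = "counting_series (\<lambda>t. d * size t)"
  have fin: "finite_levels (\<lambda>t. d * size t) A" for A :: "shape set"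
    using assms finite_levels_shape by blast
  have "t \<in> ?A \<longleftrightarrow> t \<in> ({Leaf} \<union> ?N1) \<union> ?N2" for t
    by (cases t) (auto simp: avoids_Node_top_skew_top avoids_sub_Node)
  hence "?A = ({Leaf} \<union> ?N1) \<union> ?N2" by blast
  moreover have "?c (({Leaf} \<union> ?N1) \<union> ?N2) = ?c ({Leaf} \<union> ?N1) + ?c ?N2"
    by (intro counting_series_Un fin) auto
  moreover have "?c ({Leaf} \<union> ?N1) = ?c {Leaf} + ?c ?N1"
    by (intro counting_series_Un fin) auto
  moreover have "?c (?A - {t. avoids t p}) = ?c ?A - ?c {t. avoids t p}"
    by (intro counting_series_Diff fin) (auto simp: avoids_sub_Node)
  ultimately show ?thesis
    using assms by (simp add: avoid_series_def counting_series_Node counting_series_singleton algebra_simps)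
qed

text \<open>With \<open>U\<close> the Chebyshev polynomials of the second kind, \<open>cheb y (n + 1)\<close> is
  \<open>\<surd>y ^ n * U n (1 / (2 * \<surd>y))\<close>.\<close>

fun cheb :: "'a :: comm_ring_1 \<Rightarrow> nat \<Rightarrow> 'a" where
  "cheb y 0 = 0"
| "cheb y (Suc 0) = 1"
| "cheb y (Suc (Suc n)) = cheb y (Suc n) - y * cheb y n"

text \<open>The addition theorem U(m+n) = U(m) U(n) - U(m-1) U(n-1) in rescaled form;
  \<open>cheb y 0 = 0\<close> takes care of U(-1).\<close>

lemma cheb_add: "cheb y (Suc (m + n)) = cheb y (Suc m) * cheb y (Suc n) - y * cheb y m * cheb y n"
proof (induction m rule: induct_nat_012)
  case (ge2 m)
  have "cheb y (Suc (Suc (Suc m) + n)) = cheb y (Suc (Suc m + n)) - y * cheb y (Suc (m + n))"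
    by simp
  also have "\<dots> = cheb y (Suc (Suc (Suc m))) * cheb y (Suc n) - y * cheb y (Suc (Suc m)) * cheb y n"
    unfolding ge2.IH by (simp add: algebra_simps)
  finally show ?case .
qed simp_all

text \<open>The constant term 1 makes these denominators nonzero, so they can be cancelled.\<close>

lemma cheb_nth_0: "d > 0 \<Longrightarrow> fps_nth (cheb (fps_X ^ d :: int fps) (Suc n)) 0 = 1"
  by (induction n rule: induct_nat_012) (auto simp: fps_X_power_nth)

lemma cheb_nonzero: "d > 0 \<Longrightarrow> cheb (fps_X ^ d :: int fps) (Suc n) \<noteq> 0"
  using cheb_nth_0[of d n] by auto

text \<open>With denominators cleared, F is the quotient of consecutive \<open>cheb\<close> values
  and so depends only on the length of the pattern.\<close>

lemma avoid_series_wedgelike: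
  assumes "wedgelike p" "d > 0"
  shows "avoid_series d p * cheb (fps_X ^ d) (Suc (size p)) = cheb (fps_X ^ d) (size p)"
  using assms(1)
proof (induction rule: wedgelike.induct)
  case wedgelike_Leaf
  show ?case by (simp add: avoid_series_Leaf)
next
  case (wedgelike_top p)
  define y :: "int fps" where "y = fps_X ^ d"
  define F where "F = avoid_series d (Node p Leaf)"
  have "F = 1 + y * (avoid_series d p * F)"
    unfolding F_def y_def by (rule avoid_series_top) fact
  hence "F * cheb y (Suc (size p)) = cheb y (Suc (size p)) + y * F * (avoid_series d p * cheb y (Suc (size p)))"
    by (metis (no_types, lifting) distrib_right mult.assoc mult.commute mult_1)
  also have "avoid_series d p * cheb y (Suc (size p)) = cheb y (size p)"
    using wedgelike_top by (simp add: y_def)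
  finally show ?case
    by (simp add: F_def[symmetric] y_def[symmetric] algebra_simps)
next
  case (wedgelike_skew p r)
  define y :: "int fps" where "y = fps_X ^ d"
  define a b where "a = size p" and "b = size r"
  define F P R where "F = avoid_series d (Node p (Node r Leaf))"
    and "P = avoid_series d p" and "R = avoid_series d (Node r Leaf)"
  have "R = 1 + y * (avoid_series d r * R)"
    unfolding R_def y_def by (rule avoid_series_top) fact
  hence "R * cheb y (Suc b) = cheb y (Suc b) + y * R * (avoid_series d r * cheb y (Suc b))"
    by (metis (no_types, lifting) distrib_right mult.assoc mult.commute mult_1)
  also have "avoid_series d r * cheb y (Suc b) = cheb y b"
    using wedgelike_skew by (simp add: y_def b_def)
  finally have R: "R * cheb y (Suc (Suc b)) = cheb y (Suc b)"
    by (simp add: algebra_simps)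
  have P: "P * cheb y (Suc a) = cheb y a"
    using wedgelike_skew by (simp add: y_def a_def P_def)
  have F: "F = 1 + y * (P * F + (F - P) * R)"
    unfolding F_def P_def R_def y_def by (rule avoid_series_skew) fact
  define u v where "u = cheb y (Suc a)" and "v = cheb y (Suc (Suc b))"
  \<comment> \<open>\<open>u\<close> and \<open>v\<close> are the denominators of \<open>P\<close>
    and \<open>R\<close>.\<close>
  have "F * (u * v) = u * v + y * ((P * u) * F * v + F * (R * v) * u - (P * u) * (R * v))"
    by (subst F) (simp add: algebra_simps)
  hence "F * (u * v) = u * v + y * (cheb y a * F * v + F * cheb y (Suc b) * u - cheb y a * cheb y (Suc b))"
    unfolding u_def v_def P R .
  hence "F * (cheb y (Suc (Suc a)) * v - y * u * cheb y (Suc b)) = u * v - y * cheb y a * cheb y (Suc b)"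
    by (simp add: u_def[symmetric] algebra_simps)
  hence "F * cheb y (Suc (Suc a + Suc b)) = cheb y (Suc (a + Suc b))"
    unfolding cheb_add u_def v_def .
  thus ?case by (simp add: F_def y_def a_def b_def add_ac)
qed

section \<open>Involutions\<close>

definition involution_series :: "shape \<Rightarrow> int fps" where
  "involution_series p = counting_series size {t. shape_inv t = t \<and> avoids t p}"

lemma involution_gf_word: "involution_gf (word p) = involution_series p"
proof -
  have "{t. size t = n \<and> shape_inv t = t \<and> avoids_pattern (word t) (word p)} =
      {t \<in> {t. shape_inv t = t \<and> avoids t p}. size t = n}" for n
    by (auto simp: avoids_def)
  thus ?thesis
    by (simp add: involution_gf_def involution_series_def counting_series_def num_involutions_conv_shape)
qed

lemma counting_series_involutions:
  assumes "P Leaf" "\<And>a. P (Node a Leaf) \<longleftrightarrow> Q a" "\<And>a c. P (Node a (snoc c (shape_inv a))) \<longleftrightarrow> R a \<and> P c"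
  defines "A \<equiv> {t. shape_inv t = t \<and> P t}"
  shows "counting_series size A = 1 + fps_X * counting_series size {t. shape_inv t = t \<and> Q t} +
    fps_X ^ 2 * (counting_series (\<lambda>t. 2 * size t) {t. R t} * counting_series size A)"
proof -
  let ?B = "(\<lambda>a. Node a Leaf) ` {t. shape_inv t = t \<and> Q t}"
  let ?C = "(\<lambda>(a, c). Node a (snoc c (shape_inv a))) ` ({t. R t} \<times> A)"
  have "A = ({Leaf} \<union> ?B) \<union> ?C"
  proof (intro equalityI subsetI)
    fix t assume "t \<in> A"
    hence t: "shape_inv t = t" "P t" by (auto simp: A_def)
    from t(1) consider "t = Leaf" | a where "shape_inv a = a" "t = Node a Leaf"
      | a c where "shape_inv c = c" "t = Node a (snoc c (shape_inv a))"
      unfolding shape_inv_fixed_cases[of t] by blast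
    thus "t \<in> ({Leaf} \<union> ?B) \<union> ?C"
    proof cases
      case 3
      thus ?thesis using t(2) assms(3)[of a c] by (auto simp: A_def intro!: image_eqI[of _ _ "(a, c)"])
    qed (use t assms in auto)
  qed (use assms in \<open>auto simp: A_def\<close>)
  moreover have "counting_series size (({Leaf} \<union> ?B) \<union> ?C) =
      counting_series size ({Leaf} \<union> ?B) + counting_series size ?C"
    by (intro counting_series_Un finite_levels_size) (auto dest: sym)
  moreover have "counting_series size ({Leaf} \<union> ?B) =
      counting_series size {Leaf} + counting_series size ?B"
    by (intro counting_series_Un finite_levels_size) auto
  moreover have "counting_series size ?B = counting_series (\<lambda>t. size t + 1) {t. shape_inv t = t \<and> Q t}"
    by (rule counting_series_image) (auto simp: inj_on_def)
  moreover have "counting_series size ?C =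
      counting_series (\<lambda>z. (\<lambda>(a, c). 2 * size a + size c) z + 2) ({t. R t} \<times> A)"
    by (rule counting_series_image) (auto simp: inj_on_def)
  moreover have "\<dots> = fps_X ^ 2 * (counting_series (\<lambda>t. 2 * size t) {t. R t} * counting_series size A)"
    unfolding counting_series_add_const
    by (subst counting_series_Times) (auto intro: finite_levels_size finite_levels_shape)
  ultimately show ?thesis
    by (simp add: counting_series_singleton counting_series_add_const del: add_Suc_right One_nat_def)
qed

lemma involution_series_Leaf: "involution_series Leaf = 0"
  by (rule fps_ext) (simp add: involution_series_def counting_series_def)

lemma involution_series_top:
  assumes "wedgelike p" "shape_inv p = p"
  shows "involution_series (Node p Leaf) = 1 + fps_X * involution_series p +
    fps_X ^ 2 * (avoid_series 2 p * involution_series (Node p Leaf))"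
  unfolding involution_series_def avoid_series_def
proof (rule counting_series_involutions)
  fix a c
  have "avoids (shape_inv a) p \<longleftrightarrow> avoids a p"
    using avoids_shape_inv_iff[OF assms(1), of a] assms(2) by simp
  thus "avoids (Node a (snoc c (shape_inv a))) (Node p Leaf) \<longleftrightarrow> avoids a p \<and> avoids c (Node p Leaf)"
    by (auto simp: avoids_Node_top avoids_snoc_top)
qed (simp_all add: avoids_Node_top)

lemma involution_series_double:
  assumes "wedgelike s"
  defines "\<tau> \<equiv> Node s (Node (shape_inv s) Leaf)"
  shows "involution_series \<tau> = 1 + fps_X * involution_series \<tau> +
    fps_X ^ 2 * (avoid_series 2 s * involution_series \<tau>)"
  unfolding involution_series_def avoid_series_def
proof (rule counting_series_involutions)
  fix a c
  have "avoids (shape_inv a) (shape_inv s) \<longleftrightarrow> avoids a s"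
    using avoids_shape_inv_iff[OF assms(1)] .
  thus "avoids (Node a (snoc c (shape_inv a))) \<tau> \<longleftrightarrow> avoids a s \<and> avoids c \<tau>"
    unfolding \<tau>_def using avoids_sub_Node
    by (auto simp: avoids_Node_top_skew_top avoids_snoc_top_skew_top avoids_snoc_top)
qed (simp_all add: \<tau>_def avoids_Node_top_skew_top)

lemma involution_series_top_cheb:
  assumes "wedgelike p" "shape_inv p = p"
  defines "q \<equiv> cheb (fps_X ^ 2)"
  shows "involution_series (Node p Leaf) * q (Suc (Suc (size p))) =
    q (Suc (size p)) * (1 + fps_X * involution_series p)"
proof -
  define J K where "J = involution_series (Node p Leaf)" and "K = involution_series p"
  have F: "avoid_series 2 p * q (Suc (size p)) = q (size p)"
    unfolding q_def using avoid_series_wedgelike[OF assms(1), of 2] by simp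
  have "J = 1 + fps_X * K + fps_X ^ 2 * (avoid_series 2 p * J)"
    unfolding J_def K_def using assms(1,2) by (rule involution_series_top)
  hence "J * q (Suc (size p)) =
      (1 + fps_X * K + fps_X ^ 2 * (avoid_series 2 p * J)) * q (Suc (size p))" by simp
  also have "\<dots> = q (Suc (size p)) * (1 + fps_X * K) +
      fps_X ^ 2 * J * (avoid_series 2 p * q (Suc (size p)))"
    by (simp add: algebra_simps)
  finally show ?thesis
    unfolding F J_def[symmetric] K_def[symmetric] by (simp add: q_def algebra_simps)
qed

lemma involution_series_double_cheb:
  assumes "wedgelike s"
  defines "q \<equiv> cheb (fps_X ^ 2)"
  shows "involution_series (Node s (Node (shape_inv s) Leaf)) *
    (q (Suc (Suc (size s))) - fps_X * q (Suc (size s))) = q (Suc (size s))"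
proof -
  define J where "J = involution_series (Node s (Node (shape_inv s) Leaf))"
  have F: "avoid_series 2 s * q (Suc (size s)) = q (size s)"
    unfolding q_def using avoid_series_wedgelike[OF assms(1), of 2] by simp
  have "J = 1 + fps_X * J + fps_X ^ 2 * (avoid_series 2 s * J)"
    unfolding J_def using assms(1) by (rule involution_series_double)
  hence "J * q (Suc (size s)) =
      (1 + fps_X * J + fps_X ^ 2 * (avoid_series 2 s * J)) * q (Suc (size s))" by simp
  also have "\<dots> = q (Suc (size s)) + fps_X * J * q (Suc (size s)) +
      fps_X ^ 2 * J * (avoid_series 2 s * q (Suc (size s)))"
    by (simp add: algebra_simps)
  finally show ?thesis
    unfolding F J_def[symmetric] by (simp add: q_def algebra_simps)
qed

abbreviation tops :: "nat \<Rightarrow> shape \<Rightarrow> shape" where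
  "tops k \<equiv> (\<lambda>t. Node t Leaf) ^^ k"

lemma wedgelike_tops: "wedgelike p \<Longrightarrow> wedgelike (tops k p)"
  by (induction k) (auto intro: wedgelike_top)

lemma shape_inv_tops: "shape_inv p = p \<Longrightarrow> shape_inv (tops k p) = tops k p"
  by (induction k) auto

lemma involution_series_identity_even:
  defines "q \<equiv> cheb (fps_X ^ 2)"
  shows "involution_series (tops (2 * l) Leaf) * q (Suc (2 * l)) = q l * (q (Suc l) + fps_X * q l)"
proof (induction l)
  case 0
  show ?case by (simp add: involution_series_Leaf q_def)
next
  case (Suc l)
  define J where "J k = involution_series (tops k Leaf)" for k
  have step: "J (Suc k) * q (Suc (Suc k)) = q (Suc k) + fps_X * (J k * q (Suc k))" for k
    using involution_series_top_cheb[of "tops k Leaf"] wedgelike_tops[OF wedgelike_Leaf] shape_inv_tops[of Leaf k]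
    by (simp add: J_def q_def word_funpow_top algebra_simps)
  have add: "q (Suc (m + n)) = q (Suc m) * q (Suc n) - fps_X ^ 2 * q m * q n" for m n
    unfolding q_def by (rule cheb_add)
  have "J (Suc (Suc (2 * l))) * q (Suc (Suc (Suc (2 * l)))) =
      q (Suc (Suc (2 * l))) + fps_X * (q (Suc (2 * l)) + fps_X * (J (2 * l) * q (Suc (2 * l))))"
    by (simp only: step)
  also have "J (2 * l) * q (Suc (2 * l)) = q l * (q (Suc l) + fps_X * q l)"
    using Suc by (simp add: J_def)
  also have "q (Suc (2 * l)) = q (Suc l) * q (Suc l) - fps_X ^ 2 * q l * q l"
    using add[of l l] by (simp add: mult_2)
  also have "q (Suc (Suc (2 * l))) = q (Suc (Suc l)) * q (Suc l) - fps_X ^ 2 * q (Suc l) * q l"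
    using add[of "Suc l" l] by (simp add: mult_2)
  finally show ?case
    by (simp add: J_def algebra_simps power2_eq_square)
qed

lemma involution_series_double_eq_identity:
  assumes "wedgelike s" "size s = l - 1" "l \<ge> 1"
  shows "involution_series (Node s (Node (shape_inv s) Leaf)) = involution_series (tops (2 * l) Leaf)"
proof -
  define q :: "nat \<Rightarrow> int fps" where "q = cheb (fps_X ^ 2)"
  define I J where "I = involution_series (tops (2 * l) Leaf)"
    and "J = involution_series (Node s (Node (shape_inv s) Leaf))"
  have l: "Suc (size s) = l" using assms by simp
  have "J * (q (Suc l) - fps_X * q l) = q l"
    using involution_series_double_cheb[OF assms(1)] unfolding l J_def q_def .
  hence "J * ((q (Suc l) - fps_X * q l) * (q (Suc l) + fps_X * q l)) = q l * (q (Suc l) + fps_X * q l)"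
    by (metis mult.assoc)
  also have "(q (Suc l) - fps_X * q l) * (q (Suc l) + fps_X * q l) = q (Suc (2 * l))"
    using cheb_add[of "fps_X ^ 2 :: int fps" l l]
    by (simp add: q_def algebra_simps power2_eq_square flip: mult_2)
  also have "q l * (q (Suc l) + fps_X * q l) = I * q (Suc (2 * l))"
    using involution_series_identity_even[of l] by (simp add: I_def q_def)
  finally show ?thesis
    using cheb_nonzero[of 2 "2 * l"] by (simp add: I_def J_def q_def)
qed

lemma involution_series_tops_cong:
  assumes "wedgelike p" "shape_inv p = p" "wedgelike p'" "shape_inv p' = p'" "size p = size p'"
    and "involution_series p = involution_series p'"
  shows "involution_series (tops k p) = involution_series (tops k p')"
proof (induction k)
  case (Suc k)
  have "involution_series (tops (Suc k) p) * cheb (fps_X ^ 2) (Suc (Suc (size p + k))) =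
      involution_series (tops (Suc k) p') * cheb (fps_X ^ 2) (Suc (Suc (size p + k)))"
    using involution_series_top_cheb[of "tops k p"] involution_series_top_cheb[of "tops k p'"]
      wedgelike_tops[of p k] wedgelike_tops[of p' k] shape_inv_tops[of p k] shape_inv_tops[of p' k] assms Suc
    by (simp add: word_funpow_top del: cheb.simps)
  thus ?case using cheb_nonzero[of 2 "Suc (size p + k)"] by (simp del: cheb.simps)
qed (use assms in simp)

theorem theorem2p17:
  fixes l k :: nat and \<tau> :: "nat \<Rightarrow> nat"
  assumes "l \<ge> 2" and "k \<ge> 2 * l + 1"
    and "double_wedge_pattern l \<tau>"
    and "involution_on (2 * l) \<tau>"
    and "avoids_pattern (one_line (2 * l) \<tau>) [1, 3, 2]"
  shows "involution_gf (one_line (2 * l) \<tau> @ [2 * l + 1..<k + 1]) = involution_gf [1..<k + 1]"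
proof -
  obtain s where s: "wedgelike s" "size s = l - 1"
    and \<tau>: "one_line (2 * l) \<tau> = word (Node s (Node (shape_inv s) Leaf))"
    using double_wedge_pattern_shape[of l \<tau>] assms by auto
  define T where "T = Node s (Node (shape_inv s) Leaf)"
  define I where "I = tops (2 * l) Leaf"
  have T: "wedgelike T" "shape_inv T = T" "size T = 2 * l"
    using s assms(1) wedgelike_skew wedgelike_shape_inv by (auto simp: T_def)
  have I: "wedgelike I" "shape_inv I = I" "size I = 2 * l"
    using wedgelike_tops[OF wedgelike_Leaf] shape_inv_tops[of Leaf] by (auto simp: I_def word_funpow_top)
  have "one_line (2 * l) \<tau> @ [2 * l + 1..<k + 1] = word (tops (k - 2 * l) T)"
    using assms(2) T(3) by (simp add: word_funpow_top \<tau> T_def)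
  moreover have "[1..<k + 1] = word (tops (k - 2 * l) I)"
    using assms(2) by (simp add: I_def word_funpow_top funpow_add[symmetric, THEN fun_cong, unfolded o_apply])
  moreover have "involution_series T = involution_series I"
    unfolding T_def I_def using s assms(1) by (intro involution_series_double_eq_identity) auto
  ultimately show ?thesis
    using involution_series_tops_cong[OF T(1,2) I(1,2)] T(3) I(3) by (simp add: involution_gf_word)
qed

end
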